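(* Let $(X,d,\mu)$ be a metric measure space. Suppose that for every closed and totally bounded set $F\subset\operatorname{supp}\mu$ with $\mu F>0$, there are two functions $\psi_F,\phi_F>0$ on $F$ and a constant $c_F>0$ such that for all $x\in F$ we have $\phi_F(x)\le 1$ and $$\mu B(x,r)\ge\psi_F(x)\,r^{c_F}\quad\text{whenever } 0<r\le\phi_F(x).$$ Then for all $f\in L^1_{loc}(\mu)$, $Mf(x)\ge|f|(x)$ for $\mu$-almost every $x$.
   Context: Open balls are $B(x,r):=\{y\in X: d(x,y)<r\}$ and closed balls are $B^{cl}(x,r):=\{y\in X: d(x,y)\le r\}$, $r>0$. Metric measure space: $(X,d)$ is a metric space and $\mu$ is a Borel measure (or the completion of one), not identically $0$, assigning finite measure to bounded Borel sets, and $\tau$-additive, meaning that for every collection $\{U_\alpha:\alpha\in\Lambda\}$ of open sets, $\mu(\cup_\alpha U_\alpha)=\sup \mu(\cup_{i=1}^n U_{\alpha_i})$, the supremum being over all finite subcollections. The support is defined by $(\operatorname{supp}\mu)^c:=\cup\{B(x,r): x\in X,\ \mu B(x,r)=0\}$. A set $T$ is totally bounded if for every $r>0$ it can be covered by finitely many balls of radius $r$. $L^1_{loc}(\mu)$ is the set of measurable functions that are $\mu$-integrable on every ball. The centered Hardy-Littlewood maximal function is $$Mf(x):=\sup_{\{r>0:\ 0<\mu(B^{cl}(x,r))\}}\frac{1}{\mu(B^{cl}(x,r))}\int_{B^{cl}(x,r)}|f|\,d\mu.$$ *)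

theory Defs
  imports "HOL-Analysis.Analysis"
begin

text \<open>The metric space \<open>(X, d)\<close> is the type \<open>'a\<close>. A measure \<open>M\<close> on its Borel sets may be replaced by
  its completion, in which case \<open>sets M\<close> is strictly larger than \<open>sets borel\<close> in general.\<close>

locale metric_measure_space =
  fixes M :: "'a::metric_space measure"
  assumes borel_or_completion:
      "sets M = sets borel \<or> (\<exists>N. sets N = sets borel \<and> M = completion N)"
    and not_identically_zero: "emeasure M (space M) \<noteq> 0"
    and finite_on_bounded: "\<And>A. A \<in> sets borel \<Longrightarrow> bounded A \<Longrightarrow> emeasure M A < \<infinity>"
    and tau_additive:
      "\<And>\<U>. (\<And>U. U \<in> \<U> \<Longrightarrow> open U) \<Longrightarrow>
         emeasure M (\<Union>\<U>) = (SUP \<F>\<in>{\<F>. finite \<F> \<and> \<F> \<subseteq> \<U>}. emeasure M (\<Union>\<F>))"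

definition supp :: "'a::metric_space measure \<Rightarrow> 'a set" where
  "supp M = - \<Union>{ball x r |x r. 0 < r \<and> emeasure M (ball x r) = 0}"

definition L1_loc :: "'a::metric_space measure \<Rightarrow> ('a \<Rightarrow> real) set" where
  "L1_loc M = {f \<in> borel_measurable M. \<forall>x r. 0 < r \<longrightarrow> set_integrable M (ball x r) f}"

text \<open>The value may be \<open>\<infinity>\<close>.\<close>

definition centered_maximal :: "'a::metric_space measure \<Rightarrow> ('a \<Rightarrow> real) \<Rightarrow> 'a \<Rightarrow> ennreal" where
  "centered_maximal M f x =
     (SUP r\<in>{r. 0 < r \<and> 0 < emeasure M (cball x r)}.
        (\<integral>\<^sup>+y\<in>cball x r. ennreal \<bar>f y\<bar> \<partial>M) / emeasure M (cball x r))"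

end

theory Submission
  imports Defs
begin

text \<open>
  Let \<open>s < t\<close> and let \<open>E\<close> be a bounded set of points at which \<open>\<bar>f\<bar> \<ge> t\<close>, while all averages of
  \<open>\<bar>f\<bar>\<close> over centered closed balls are at most \<open>s\<close>. By \<open>\<tau>\<close>-additivity almost all of the space is covered by
  countably many closed totally bounded subsets \<open>F\<close> of the support, so one may assume \<open>E \<subseteq> F\<close>.
  The polynomial lower bound with exponent \<open>c\<close> forces the measure to be doubling with constant
  \<open>3 powr (c + 1)\<close> at infinitely many of the scales \<open>3\<^sup>-\<^sup>n\<close> around every point of \<open>F\<close>: otherwise
  the measure of the balls would decay faster than the bound allows. The constant does not depend
  on the point, so Vitali's covering argument applies to the balls at these scales. It yields disjoint
  balls that cover almost all of \<open>E\<close> and lie in an open set \<open>U\<close> which is barely larger than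
  \<open>{\<bar>f\<bar> \<ge> t}\<close>. On the union \<open>V\<close> of these balls the average of \<open>\<bar>f\<bar>\<close> is at most \<open>s\<close>, whereas
  \<open>\<bar>f\<bar> \<ge> t\<close> on nearly all of \<open>V\<close>; hence \<open>V\<close>, and with it \<open>E\<close>, has arbitrarily small measure.
\<close>

section \<open>Disjoint selection and countable families of sets\<close>

text \<open>Zorn's lemma provides a maximal admissible disjoint subfamily. If some set missed all of
  its members, an index of least rank among such sets could be added, against maximality. In the
  application the rank is the exponent \<open>n\<close> of the radius \<open>(1/3) ^ n\<close>, so a
  smaller rank means a larger ball.\<close>

lemma Vitali_selection_by_rank:
  fixes S :: "'i \<Rightarrow> 'b set" and rank :: "'i \<Rightarrow> nat"
  assumes nonempty: "\<And>i. i \<in> K \<Longrightarrow> S i \<noteq> {}"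
  obtains C where "C \<subseteq> K" "pairwise (\<lambda>i j. disjnt (S i) (S j)) C"
    "\<And>i. i \<in> K \<Longrightarrow> \<exists>j\<in>C. \<not> disjnt (S i) (S j) \<and> rank j \<le> rank i"
proof -
  \<comment> \<open>The rank condition is imposed only on indices that already meet
    \<open>C\<close>; in this form it holds for the empty family and passes to unions of
    chains.\<close>
  define \<A> where "\<A> = {C. C \<subseteq> K \<and> pairwise (\<lambda>i j. disjnt (S i) (S j)) C \<and>
    (\<forall>i\<in>K. (\<exists>j\<in>C. \<not> disjnt (S i) (S j)) \<longrightarrow>
      (\<exists>j\<in>C. \<not> disjnt (S i) (S j) \<and> rank j \<le> rank i))}"
  have "\<Union>\<C> \<in> \<A>" if "subset.chain \<A> \<C>" for \<C>
  proof -
    have sub: "\<C> \<subseteq> \<A>" and total: "\<And>X Y. X \<in> \<C> \<Longrightarrow> Y \<in> \<C> \<Longrightarrow> X \<subseteq> Y \<or> Y \<subseteq> X"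
      using that by (auto simp: subset_chain_def)
    have "pairwise (\<lambda>i j. disjnt (S i) (S j)) (\<Union>\<C>)"
    proof (rule pairwiseI)
      fix i j assume "i \<in> \<Union>\<C>" "j \<in> \<Union>\<C>" "i \<noteq> j"
      then obtain X where "X \<in> \<C>" "i \<in> X" "j \<in> X" using total by blast
      then show "disjnt (S i) (S j)"
        using sub \<open>i \<noteq> j\<close> by (auto simp: \<A>_def pairwise_def)
    qed
    moreover have "\<exists>j\<in>\<Union>\<C>. \<not> disjnt (S i) (S j) \<and> rank j \<le> rank i"
      if i: "i \<in> K" "j \<in> \<Union>\<C>" "\<not> disjnt (S i) (S j)" for i j
    proof -
      obtain X where X: "X \<in> \<C>" "j \<in> X" using i by blast
      then have "\<exists>j\<in>X. \<not> disjnt (S i) (S j) \<and> rank j \<le> rank i"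
        using sub i unfolding \<A>_def by blast
      then show ?thesis using X by blast
    qed
    moreover have "\<Union>\<C> \<subseteq> K" using sub by (auto simp: \<A>_def)
    ultimately show ?thesis unfolding \<A>_def mem_Collect_eq by blast
  qed
  from subset_Zorn'[of \<A>, OF this] obtain C
    where C: "C \<in> \<A>" and max: "\<And>X. X \<in> \<A> \<Longrightarrow> C \<subseteq> X \<Longrightarrow> X = C" by blast
  have meets: "\<exists>j\<in>C. \<not> disjnt (S i) (S j)" if "i \<in> K" for i
  proof (rule ccontr)
    let ?Q = "\<lambda>i. i \<in> K \<and> (\<forall>j\<in>C. disjnt (S i) (S j))"
    assume "\<not> ?thesis"
    then have "?Q i" using that by blast
    then obtain i0 where i0: "?Q i0" and least: "\<And>i'. ?Q i' \<Longrightarrow> rank i0 \<le> rank i'"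
      using arg_min_natI[of ?Q i rank] arg_min_nat_le[of ?Q _ rank] by blast
    have "insert i0 C \<in> \<A>"
    proof -
      have "pairwise (\<lambda>i j. disjnt (S i) (S j)) (insert i0 C)"
        using C i0 by (auto simp: \<A>_def pairwise_insert disjnt_sym)
      moreover have "\<exists>j\<in>insert i0 C. \<not> disjnt (S i') (S j) \<and> rank j \<le> rank i'"
        if "i' \<in> K" "j \<in> insert i0 C" "\<not> disjnt (S i') (S j)" for i' j
      proof (cases "?Q i'")
        case True
        \<comment> \<open>Such an index misses all of \<open>C\<close>, so the member it meets is
          \<open>i0\<close>, and \<open>i0\<close> has least rank.\<close>
        then show ?thesis using that least by auto
      next
        case False
        then have "\<exists>j\<in>C. \<not> disjnt (S i') (S j) \<and> rank j \<le> rank i'"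
          using C that(1) unfolding \<A>_def by blast
        then show ?thesis by blast
      qed
      ultimately show ?thesis using C i0 by (auto simp: \<A>_def)
    qed
    then have "i0 \<in> C" using max[of "insert i0 C"] by blast
    then show False using i0 nonempty by (auto simp: disjnt_def)
  qed
  show thesis
  proof (rule that[of C])
    show "C \<subseteq> K" "pairwise (\<lambda>i j. disjnt (S i) (S j)) C" using C by (auto simp: \<A>_def)
    show "\<exists>j\<in>C. \<not> disjnt (S i) (S j) \<and> rank j \<le> rank i" if "i \<in> K" for i
      using C meets[OF that] that unfolding \<A>_def by blast
  qed
qed

text \<open>Finite partial sums of the measures are bounded by \<open>measure M U\<close>. The
  family of measures is therefore summable, and a summable family has only countably many nonzero
  terms.\<close>

lemma countable_disjoint_positive_measure:
  assumes sets: "\<And>i. i \<in> I \<Longrightarrow> B i \<in> sets M" and disj: "disjoint_family_on B I"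
    and pos: "\<And>i. i \<in> I \<Longrightarrow> 0 < emeasure M (B i)"
    and sub: "\<And>i. i \<in> I \<Longrightarrow> B i \<subseteq> U" and U: "U \<in> sets M" "emeasure M U < \<infinity>"
  shows "countable I"
proof -
  have fin: "emeasure M A \<noteq> \<infinity>" if "A \<subseteq> U" for A
    using emeasure_mono[OF that U(1)] U(2) by (auto simp: top_unique)
  have "sum (\<lambda>i. measure M (B i)) J \<le> measure M U" if J: "finite J" "J \<subseteq> I" for J
  proof -
    have "sum (\<lambda>i. measure M (B i)) J = measure M (\<Union>i\<in>J. B i)"
      using J sets sub fin disj
      by (intro measure_finite_Union[symmetric]) (auto intro: disjoint_family_on_mono)
    also have "\<dots> \<le> measure M U"
      using J sets sub U by (intro measure_mono_fmeasurable) (auto simp: fmeasurable_def)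
    finally show ?thesis .
  qed
  then have "(\<lambda>i. measure M (B i)) summable_on I"
    by (intro nonneg_bdd_above_summable_on bdd_aboveI[of _ "measure M U"]) auto
  then have "countable {i\<in>I. measure M (B i) \<noteq> 0}"
    by (intro abs_summable_countable) auto
  moreover have "{i\<in>I. measure M (B i) \<noteq> 0} = I"
    using pos fin sub by (force simp: measure_def enn2real_eq_0_iff)
  ultimately show ?thesis by simp
qed

text \<open>Along an enumeration of \<open>I\<close> the unions of the tails decrease to the empty
  set, since each point lies in at most one \<open>B i\<close>. Finite total measure permits
  continuity from above.\<close>

lemma disjoint_tail_small:
  assumes sets: "\<And>i. i \<in> I \<Longrightarrow> B i \<in> sets M" and disj: "disjoint_family_on B I"
    and I: "countable I"
    and fin: "emeasure M (\<Union>i\<in>I. B i) < \<infinity>" and e: "(0::ennreal) < e"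
  obtains J where "finite J" "J \<subseteq> I" "emeasure M (\<Union>i\<in>I - J. B i) < e"
proof -
  define J where "J n = {i\<in>I. to_nat_on I i < n}" for n
  define T where "T n = (\<Union>i\<in>I - J n. B i)" for n
  have T: "range T \<subseteq> sets M" using sets I by (auto simp: T_def intro!: sets.countable_UN')
  moreover have "decseq T" by (auto simp: decseq_def T_def J_def)
  moreover have "emeasure M (T n) \<noteq> \<infinity>" for n
  proof -
    have "emeasure M (T n) \<le> emeasure M (\<Union>i\<in>I. B i)"
      using sets I by (intro emeasure_mono sets.countable_UN') (auto simp: T_def)
    then show ?thesis using fin by auto
  qed
  ultimately have "(\<lambda>n. emeasure M (T n)) \<longlonglongrightarrow> emeasure M (\<Inter>n. T n)" by (rule Lim_emeasure_decseq)
  moreover have "(\<Inter>n. T n) = {}"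
  proof safe
    fix x assume x: "x \<in> (\<Inter>n. T n)"
    then obtain i where i: "i \<in> I" "x \<in> B i" by (auto simp: T_def)
    from x obtain j where j: "j \<in> I - J (Suc (to_nat_on I i))" "x \<in> B j" unfolding T_def by blast
    with i disj have "j = i" by (force simp: disjoint_family_on_def)
    with j show "x \<in> {}" by (auto simp: J_def)
  qed
  ultimately have "(\<lambda>n. emeasure M (T n)) \<longlonglongrightarrow> 0" by simp
  then obtain n where n: "emeasure M (T n) < e"
    using order_tendstoD(2)[OF _ e] by (fastforce simp: eventually_sequentially)
  have "finite (J n)"
  proof (rule finite_imageD)
    show "finite (to_nat_on I ` J n)" by (rule finite_subset[of _ "{..<n}"]) (auto simp: J_def)
    show "inj_on (to_nat_on I) (J n)"
      using inj_on_to_nat_on[OF I] by (rule inj_on_subset) (auto simp: J_def)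
  qed
  then show thesis using n by (intro that[of "J n"]) (auto simp: J_def T_def)
qed

text \<open>Countable subadditivity with the sum written as an integral over
  \<open>count_space I\<close>, so that it can be chained with \<open>emeasure_UN_countable\<close>,
  which treats disjoint families in the same form.\<close>

lemma emeasure_UN_countable_le:
  assumes X: "\<And>i. i \<in> I \<Longrightarrow> X i \<in> sets M" and I: "countable I"
  shows "emeasure M (\<Union>(X ` I)) \<le> (\<integral>\<^sup>+i. emeasure M (X i) \<partial>count_space I)"
proof -
  have le: "indicator (\<Union>(X ` I)) x \<le> (\<integral>\<^sup>+i. indicator (X i) x \<partial>count_space I)" for x
  proof (cases "x \<in> \<Union>(X ` I)")
    case True
    then obtain i where i: "i \<in> I" "x \<in> X i" by auto
    have "(1::ennreal) = (\<integral>\<^sup>+j. indicator {i} j \<partial>count_space I)"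
      using i by (simp add: one_ennreal_def)
    also have "\<dots> \<le> (\<integral>\<^sup>+j. indicator (X j) x \<partial>count_space I)"
      using i by (intro nn_integral_mono) (auto split: split_indicator)
    finally show ?thesis using True by simp
  qed simp
  have "emeasure M (\<Union>(X ` I)) = (\<integral>\<^sup>+x. indicator (\<Union>(X ` I)) x \<partial>M)"
    using X I by (intro nn_integral_indicator[symmetric] sets.countable_UN') auto
  also have "\<dots> \<le> (\<integral>\<^sup>+x. \<integral>\<^sup>+i. indicator (X i) x \<partial>count_space I \<partial>M)"
    by (intro nn_integral_mono le)
  also have "\<dots> = (\<integral>\<^sup>+i. \<integral>\<^sup>+x. indicator (X i) x \<partial>M \<partial>count_space I)"
    using X I by (intro nn_integral_count_space_nn_integral) auto
  also have "\<dots> = (\<integral>\<^sup>+i. emeasure M (X i) \<partial>count_space I)"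
    using X by (intro nn_integral_cong) auto
  finally show ?thesis .
qed

text \<open>The covers for \<open>e = 1 / Suc n\<close> intersect in a null set. Covers take the
  place of the measure of \<open>E\<close> because \<open>E\<close> may fail to be measurable;
  \<open>c\<close> absorbs the constant of an estimate.\<close>

lemma AE_notin_if_arbitrarily_small_cover:
  fixes c :: ennreal
  assumes c: "c < \<infinity>"
    and small: "\<And>e::real. 0 < e \<Longrightarrow> \<exists>D\<in>sets M. (AE x in M. x \<in> E \<longrightarrow> x \<in> D) \<and> emeasure M D \<le> c * ennreal e"
  shows "AE x in M. x \<notin> E"
proof -
  have "\<forall>n::nat. \<exists>D\<in>sets M. (AE x in M. x \<in> E \<longrightarrow> x \<in> D) \<and> emeasure M D \<le> c * ennreal (1 / Suc n)"
    using small by simp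
  then obtain D where D: "\<And>n. D n \<in> sets M" "\<And>n. AE x in M. x \<in> E \<longrightarrow> x \<in> D n"
    "\<And>n. emeasure M (D n) \<le> c * ennreal (1 / Suc n)" by metis
  let ?N = "\<Inter>n. D n"
  have N: "?N \<in> sets M" using D(1) by (intro sets.countable_INT) auto
  have "(\<lambda>n. ennreal (1 / Suc n)) \<longlonglongrightarrow> ennreal 0"
    by (intro tendsto_ennrealI LIMSEQ_Suc[OF lim_1_over_n])
  then have "(\<lambda>n. c * ennreal (1 / Suc n)) \<longlonglongrightarrow> 0"
    using ennreal_tendsto_cmult[of c "\<lambda>n. ennreal (1 / Suc n)" 0] c by simp
  moreover have "emeasure M ?N \<le> c * ennreal (1 / Suc n)" for n
    using emeasure_mono[of ?N "D n" M] D(1) D(3)[of n] by (meson INT_lower UNIV_I order_trans)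
  ultimately have "emeasure M ?N \<le> 0"
    by (intro LIMSEQ_le_const) auto
  then have "AE x in M. x \<notin> ?N" using N by (intro AE_not_in) (auto simp: null_sets_def)
  moreover have "AE x in M. \<forall>n. x \<in> E \<longrightarrow> x \<in> D n" using D(2) unfolding AE_all_countable by blast
  ultimately show ?thesis by eventually_elim auto
qed

section \<open>Vitali covering by balls at doubling scales\<close>

text \<open>A pair \<open>(x, n)\<close> encodes the ball with centre \<open>x\<close> and radius
  \<open>(1/3) ^ n\<close>. Whatever finite set \<open>J\<close> of selected balls is set aside, the
  uncovered part of \<open>E\<close> lies in the threefold enlargements of the others. Doubling
  bounds their total measure by \<open>c\<close> times the measure of a tail of a disjoint family,
  which is as small as desired.\<close>

lemma doubling_Vitali_covering:
  fixes M :: "'a::metric_space measure" and c :: ennreal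
  defines "B \<equiv> \<lambda>p::'a \<times> nat. cball (fst p) ((1/3) ^ snd p)"
  assumes borel: "sets borel \<subseteq> sets M"
    and U: "open U" "emeasure M U < \<infinity>" "E \<subseteq> U" and c: "c < \<infinity>"
    and doubling: "\<And>x m. x \<in> E \<Longrightarrow> \<exists>n\<ge>m. 0 < emeasure M (cball x ((1/3) ^ n)) \<and>
      emeasure M (cball x (3 * (1/3) ^ n)) \<le> c * emeasure M (cball x ((1/3) ^ n))"
  obtains C where "countable C" "fst ` C \<subseteq> E" "disjoint_family_on B C" "(\<Union>p\<in>C. B p) \<subseteq> U"
    "AE x in M. x \<in> E \<longrightarrow> x \<in> (\<Union>p\<in>C. B p)"
proof -
  have B_sets: "B p \<in> sets M" for p
    using borel borel_closed[OF closed_cball] unfolding B_def by blast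
  have U_sets: "U \<in> sets M" using borel borel_open[OF U(1)] by blast
  define K where "K = {p. fst p \<in> E \<and> B p \<subseteq> U \<and> 0 < emeasure M (B p) \<and>
    emeasure M (cball (fst p) (3 * (1/3) ^ snd p)) \<le> c * emeasure M (B p)}"
  \<comment> \<open>The balls in \<open>K\<close> form a fine cover of \<open>E\<close>: arbitrarily
    small ones exist around every point, because doubling occurs at arbitrarily large
    \<open>n\<close>.\<close>
  have fine: "\<exists>n. (x, n) \<in> K \<and> B (x, n) \<subseteq> W" if x: "x \<in> E" "open W" "x \<in> W" for x W
  proof -
    have "open (U \<inter> W)" "x \<in> U \<inter> W" using U x by auto
    then obtain e where e: "0 < e" "cball x e \<subseteq> U \<inter> W"
      using open_contains_cball by blast
    obtain m where m: "(1/3) ^ m < e" using real_arch_pow_inv[of e "1/3"] e(1) by auto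
    obtain n where n: "n \<ge> m" "0 < emeasure M (cball x ((1/3) ^ n))"
      "emeasure M (cball x (3 * (1/3) ^ n)) \<le> c * emeasure M (cball x ((1/3) ^ n))"
      using doubling[OF x(1)] by blast
    have "(1/3::real) ^ n \<le> (1/3) ^ m" using n(1) by (intro power_decreasing) auto
    with m have "(1/3) ^ n \<le> e" by (rule order.strict_implies_order[OF le_less_trans, rotated])
    then have "cball x ((1/3) ^ n) \<subseteq> cball x e" by (rule subset_cball)
    then have "B (x, n) \<subseteq> U \<inter> W" using e unfolding B_def by auto
    then show ?thesis using n x by (intro exI[of _ n]) (auto simp: K_def B_def)
  qed
  obtain C where C: "C \<subseteq> K" "pairwise (\<lambda>i j. disjnt (B i) (B j)) C"
    and select: "\<And>i. i \<in> K \<Longrightarrow> \<exists>j\<in>C. \<not> disjnt (B i) (B j) \<and> snd j \<le> snd i"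
  proof (rule Vitali_selection_by_rank[of K B snd])
    show "B i \<noteq> {}" for i by (auto simp: B_def)
  qed blast
  have disj: "disjoint_family_on B C"
    using C(2) by (auto simp: disjoint_family_on_def pairwise_def disjnt_def)
  have count: "countable C"
    by (rule countable_disjoint_positive_measure[OF B_sets disj _ _ U_sets U(2)])
      (use C(1) in \<open>auto simp: K_def\<close>)
  have VU: "(\<Union>p\<in>C. B p) \<subseteq> U" using C(1) by (auto simp: K_def)
  have V_sets: "(\<Union>p\<in>C'. B p) \<in> sets M" if "C' \<subseteq> C" for C'
    using B_sets countable_subset[OF that count] by (intro sets.countable_UN') auto
  have V_fin: "emeasure M (\<Union>p\<in>C. B p) < \<infinity>"
    using emeasure_mono[OF VU U_sets] U(2) by (rule le_less_trans)
  define V3 where "V3 J = (\<Union>p\<in>C - J. cball (fst p) (3 * (1/3) ^ snd p))" for J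
  have V3_sets: "V3 J \<in> sets M" for J
    unfolding V3_def using borel count
    by (intro sets.countable_UN') (auto intro!: subsetD[OF borel])
  have cover: "E - (\<Union>p\<in>C. B p) \<subseteq> V3 J" if J: "finite J" for J
  proof
    fix x assume x: "x \<in> E - (\<Union>p\<in>C. B p)"
    \<comment> \<open>Only finitely many closed balls are removed, so \<open>?W\<close> is an open
      neighbourhood of \<open>x\<close>. A ball of \<open>K\<close> inside it can meet only selected
      balls outside \<open>J\<close>.\<close>
    let ?W = "- (\<Union>p\<in>J \<inter> C. B p)"
    have "open ?W" using J by (intro open_Compl closed_UN) (auto simp: B_def)
    then obtain n where n: "(x, n) \<in> K" "B (x, n) \<subseteq> ?W" using fine[of x ?W] x by blast
    then obtain p where p: "p \<in> C" "\<not> disjnt (B (x, n)) (B p)" "snd p \<le> n"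
      using select by fastforce
    then have "p \<notin> J" using n(2) by (auto simp: disjnt_def)
    obtain y where y: "dist x y \<le> (1/3) ^ n" "dist (fst p) y \<le> (1/3) ^ snd p"
      using p(2) by (auto simp: disjnt_def B_def)
    \<comment> \<open>The selected ball is at least as large as the one around \<open>x\<close>, so
      \<open>x\<close> is within two of its radii from its centre; the factor 3 leaves room.\<close>
    have "dist (fst p) x \<le> dist (fst p) y + dist x y" by (metis dist_commute dist_triangle)
    also have "\<dots> \<le> (1/3) ^ snd p + (1/3) ^ n" using y by simp
    also have "(1/3::real) ^ n \<le> (1/3) ^ snd p" using p(3) by (intro power_decreasing) auto
    finally have "dist (fst p) x \<le> 2 * (1/3) ^ snd p" by simp
    then have "x \<in> cball (fst p) (3 * (1/3) ^ snd p)"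
      using zero_le_power[of "1/3::real" "snd p"] unfolding mem_cball by linarith
    then show "x \<in> V3 J" using p \<open>p \<notin> J\<close> unfolding V3_def by blast
  qed
  have small: "\<exists>J. finite J \<and> emeasure M (V3 J) \<le> c * ennreal e" if e: "0 < ennreal e" for e
  proof -
    obtain J where J: "finite J" "J \<subseteq> C" "emeasure M (\<Union>p\<in>C - J. B p) < ennreal e"
      using disjoint_tail_small[OF B_sets disj count V_fin e] by blast
    have count': "countable (C - J)" using count by auto
    have "emeasure M (V3 J) \<le> (\<integral>\<^sup>+p. emeasure M (cball (fst p) (3 * (1/3) ^ snd p)) \<partial>count_space (C - J))"
      unfolding V3_def using count' by (intro emeasure_UN_countable_le) (auto intro!: subsetD[OF borel])
    also have "\<dots> \<le> (\<integral>\<^sup>+p. c * emeasure M (B p) \<partial>count_space (C - J))"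
      using C(1) by (intro nn_integral_mono) (auto simp: K_def)
    also have "\<dots> = c * (\<integral>\<^sup>+p. emeasure M (B p) \<partial>count_space (C - J))"
      by (rule nn_integral_cmult) simp
    also have "\<dots> = c * emeasure M (\<Union>p\<in>C - J. B p)"
      using count' disj B_sets
      by (subst emeasure_UN_countable) (auto intro: disjoint_family_on_mono)
    also have "\<dots> \<le> c * ennreal e" using J(3) by (intro mult_left_mono) auto
    finally show ?thesis using J by blast
  qed
  have "AE x in M. x \<notin> E - (\<Union>p\<in>C. B p)"
  proof (rule AE_notin_if_arbitrarily_small_cover[OF c])
    fix e :: real assume "0 < e"
    then obtain J where J: "finite J" "emeasure M (V3 J) \<le> c * ennreal e" using small by auto
    then show "\<exists>D\<in>sets M. (AE x in M. x \<in> E - (\<Union>p\<in>C. B p) \<longrightarrow> x \<in> D) \<and> emeasure M D \<le> c * ennreal e"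
      using V3_sets cover[OF J(1)] by (intro bexI[of _ "V3 J"] conjI AE_I2) auto
  qed
  then have ae: "AE x in M. x \<in> E \<longrightarrow> x \<in> (\<Union>p\<in>C. B p)" by simp
  show thesis
    by (rule that[OF count _ disj VU ae]) (use C(1) in \<open>auto simp: K_def\<close>)
qed

section \<open>Doubling from a polynomial lower bound\<close>

text \<open>If the inequality failed from \<open>m\<close> on, \<open>a (m + k)\<close> would be at
  most \<open>a m\<close> times \<open>3 powr (- (c + 1) * k)\<close>. The lower bound decays only
  like \<open>3 powr (- c * k)\<close>, so a factor \<open>3 ^ k\<close> would stay bounded.\<close>

lemma geometric_doubling_scale:
  fixes a :: "nat \<Rightarrow> real"
  assumes c: "0 < c" and psi: "0 < \<psi>" and lower: "\<And>n. n \<ge> m \<Longrightarrow> \<psi> * (1/3) powr (c * real n) \<le> a n"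
  shows "\<exists>n\<ge>m. a n \<le> 3 powr (c + 1) * a (Suc n)"
proof (rule ccontr)
  assume "\<not> ?thesis"
  then have *: "3 powr (c + 1) * a (Suc n) < a n" if "n \<ge> m" for n using that by force
  have bound: "3 powr ((c + 1) * real k) * a (m + k) \<le> a m" for k
  proof (induction k)
    case (Suc k)
    have "3 powr ((c + 1) * real (Suc k)) * a (m + Suc k)
        = 3 powr ((c + 1) * real k) * (3 powr (c + 1) * a (Suc (m + k)))"
      by (simp add: powr_add[symmetric] algebra_simps)
    also have "\<dots> \<le> 3 powr ((c + 1) * real k) * a (m + k)"
      using *[of "m + k"] by (intro mult_left_mono) auto
    finally show ?case using Suc by simp
  qed simp
  \<comment> \<open>The surplus 1 in the exponent \<open>c + 1\<close> produces the factor
    \<open>3 ^ k\<close>, and \<open>k\<close> is chosen to make it exceed the ratio of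
    \<open>a m\<close> to the lower bound at \<open>m\<close>.\<close>
  obtain k where k: "a m / (\<psi> * (1/3) powr (c * real m)) < 3 ^ k"
    using real_arch_pow[of 3] by auto
  have pos: "0 < \<psi> * (1/3) powr (c * real m)" using psi by simp
  have "3 ^ k * (\<psi> * (1/3) powr (c * real m))
      = 3 powr ((c + 1) * real k) * (\<psi> * (1/3) powr (c * real (m + k)))"
  proof -
    have "(1/3::real) powr y = 3 powr (- y)" for y by (simp add: powr_minus powr_divide field_simps)
    moreover have "(3::real) ^ k = 3 powr k" by (simp add: powr_realpow)
    moreover have "3 powr real k * 3 powr (- (c * real m))
       = 3 powr ((c + 1) * real k) * 3 powr (- (c * real (m + k)))"
      by (simp add: powr_add[symmetric] algebra_simps)
    ultimately show ?thesis by simp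
  qed
  also have "\<dots> \<le> 3 powr ((c + 1) * real k) * a (m + k)"
    using lower[of "m + k"] by (intro mult_left_mono) auto
  also have "\<dots> \<le> a m" by (rule bound)
  finally show False using k pos by (simp add: field_simps)
qed

section \<open>Approximation of measurable sets by closed and open sets\<close>

text \<open>Induction over the sigma-algebra generated by the closed sets. Inner and outer
  approximation are carried together, so that complementation merely exchanges them. Restriction to
  \<open>B\<close> makes the measures finite.\<close>

lemma closed_open_approximation:
  fixes M :: "'a::metric_space measure"
  assumes borel: "sets borel \<subseteq> sets M" and B: "open B" "emeasure M B < \<infinity>"
    and A: "A \<in> sets borel" and e: "(0::real) < e"
  shows "\<exists>F U. closed F \<and> open U \<and> F \<subseteq> A \<and> A \<subseteq> U \<and> emeasure M (B \<inter> (U - F)) < ennreal e"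
proof -
  have B_sets: "B \<in> sets M" using B borel borel_open by blast
  have meas: "B \<inter> (U - F) \<in> sets M" if "open U" "closed F" for U F
    using that B_sets borel borel_open[OF that(1)] borel_closed[OF that(2)]
    by (intro sets.Int sets.Diff) auto
  have fin: "emeasure M (B \<inter> X) \<noteq> \<infinity>" for X
    using emeasure_mono[of "B \<inter> X" B M] B_sets B(2) by (auto simp: top_unique)
  \<comment> \<open>Continuity from above inside \<open>B\<close>, used for closed sets and for
    countable unions.\<close>
  have vanish: "\<exists>n. emeasure M (B \<inter> (U n - F n)) < ennreal d"
    if "\<And>n. open (U n)" "\<And>n. closed (F n)" "decseq (\<lambda>n. U n - F n)"
      "emeasure M (B \<inter> (\<Inter>n. U n - F n)) < ennreal d" for U F :: "nat \<Rightarrow> 'a set" and d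
  proof -
    have "decseq (\<lambda>n. B \<inter> (U n - F n))" using that(3) unfolding decseq_def by blast
    then have "(\<lambda>n. emeasure M (B \<inter> (U n - F n))) \<longlonglongrightarrow> emeasure M (\<Inter>n. B \<inter> (U n - F n))"
      using that fin meas by (intro Lim_emeasure_decseq) auto
    moreover have "(\<Inter>n. B \<inter> (U n - F n)) = B \<inter> (\<Inter>n. U n - F n)" by auto
    ultimately have "\<forall>\<^sub>F n in sequentially. emeasure M (B \<inter> (U n - F n)) < ennreal d"
      using that(4) by (metis order_tendstoD(2))
    then show ?thesis by (auto simp: eventually_sequentially)
  qed
  have "A \<in> sigma_sets UNIV (Collect closed)"
    using A by (simp add: borel_eq_closed)
  then show ?thesis using e
  proof (induction arbitrary: e)
    case (Basic A)
    \<comment> \<open>These open neighbourhoods shrink to the closure of \<open>A\<close>, which is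
      \<open>A\<close> itself.\<close>
    define U where "U n = (\<Union>x\<in>A. ball x (1 / Suc n))" for n :: nat
    have U: "open (U n)" "A \<subseteq> U n" for n
      unfolding U_def by (blast, force intro: centre_in_ball[THEN iffD2])
    have "\<exists>n. emeasure M (B \<inter> (U n - A)) < ennreal e"
    proof (rule vanish[OF U(1)])
      show "closed A" using Basic by simp
      show "decseq (\<lambda>n. U n - A)"
      proof (rule decseq_SucI)
        fix n
        have "ball x (1 / Suc (Suc n)) \<subseteq> ball x (1 / Suc n)" for x :: 'a
          by (intro subset_ball divide_left_mono) auto
        then show "U (Suc n) - A \<subseteq> U n - A" by (auto simp: U_def)
      qed
      have "x \<in> closure A" if x: "\<And>n. x \<in> U n" for x
        unfolding closure_approachable
      proof safe
        fix d :: real assume "0 < d"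
        then obtain n where n: "1 / Suc n < d" using nat_approx_posE by blast
        obtain y where "y \<in> A" "dist y x < 1 / Suc n" using x[of n] by (auto simp: U_def)
        then show "\<exists>y\<in>A. dist y x < d" using n by force
      qed
      then have eq: "(\<Inter>n. U n - A) = {}" using Basic by (auto simp: closure_closed)
      show "emeasure M (B \<inter> (\<Inter>n. U n - A)) < ennreal e" unfolding eq using Basic by simp
    qed
    then obtain n where "emeasure M (B \<inter> (U n - A)) < ennreal e" by blast
    with U[of n] Basic show ?case by (intro exI[of _ A] exI[of _ "U n"]) simp
  next
    case Empty
    then show ?case by (intro exI[of _ "{}"]) auto
  next
    case (Compl A)
    from Compl.IH[OF Compl.prems] obtain F U
      where FU: "closed F" "open U" "F \<subseteq> A" "A \<subseteq> U" "emeasure M (B \<inter> (U - F)) < ennreal e" by blast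
    have "- F - - U = U - F" "UNIV - A = - A" by auto
    with FU have "closed (- U)" "open (- F)" "- U \<subseteq> UNIV - A" "UNIV - A \<subseteq> - F"
      "emeasure M (B \<inter> (- F - - U)) < ennreal e"
      by (simp_all add: closed_Compl open_Compl)
    then show ?case by (intro exI[of _ "- U"] exI[of _ "- F"] conjI)
  next
    case (Union A)
    \<comment> \<open>The errors add up to \<open>e/2\<close>; the other half is slack for keeping
      only finitely many \<open>F k\<close>, whose union is then closed.\<close>
    have "\<forall>n. \<exists>F U. closed F \<and> open U \<and> F \<subseteq> A n \<and> A n \<subseteq> U \<and>
        emeasure M (B \<inter> (U - F)) < ennreal (e/2 * (1/2) ^ Suc n)"
      using Union by simp
    then obtain F U where FU: "\<And>n. closed (F n)" "\<And>n. open (U n)" "\<And>n. F n \<subseteq> A n" "\<And>n. A n \<subseteq> U n"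
      "\<And>n. emeasure M (B \<inter> (U n - F n)) < ennreal (e/2 * (1/2) ^ Suc n)" by metis
    have "B \<inter> (\<Inter>n. (\<Union>k. U k) - (\<Union>k<n. F k)) \<subseteq> (\<Union>n. B \<inter> (U n - F n))"
      by blast
    then have "emeasure M (B \<inter> (\<Inter>n. (\<Union>k. U k) - (\<Union>k<n. F k))) \<le> emeasure M (\<Union>n. B \<inter> (U n - F n))"
      using meas[OF FU(2,1)] by (intro emeasure_mono sets.countable_UN) auto
    also have "\<dots> \<le> (\<Sum>n. emeasure M (B \<inter> (U n - F n)))"
      using meas[OF FU(2,1)] by (intro emeasure_subadditive_countably) auto
    also have "\<dots> \<le> (\<Sum>n. ennreal (e/2 * (1/2) ^ Suc n))"
      using FU(5) by (intro suminf_le) (auto intro: less_imp_le)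
    also have "\<dots> = ennreal (e/2)"
      using sums_mult[OF power_half_series, of "e/2"] Union.prems
      by (intro suminf_ennreal_eq) auto
    also have "\<dots> < ennreal e" using Union.prems by (intro ennreal_lessI) auto
    finally have small: "emeasure M (B \<inter> (\<Inter>n. (\<Union>k. U k) - (\<Union>k<n. F k))) < ennreal e" .
    have "\<exists>n. emeasure M (B \<inter> ((\<Union>k. U k) - (\<Union>k<n. F k))) < ennreal e"
    proof (rule vanish[OF _ _ _ small])
      show "open (\<Union>k. U k)" using FU(2) by blast
      show "closed (\<Union>k<n. F k)" for n using FU(1) by (intro closed_UN) auto
      show "decseq (\<lambda>n. (\<Union>k. U k) - (\<Union>k<n. F k))" by (force simp: decseq_def)
    qed
    then obtain n where n: "emeasure M (B \<inter> ((\<Union>k. U k) - (\<Union>k<n. F k))) < ennreal e" ..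
    moreover have "closed (\<Union>k<n. F k)" using FU(1) by (intro closed_UN) auto
    moreover have "open (\<Union>k. U k)" "(\<Union>k<n. F k) \<subseteq> (\<Union>k. A k)" "(\<Union>k. A k) \<subseteq> (\<Union>k. U k)"
      using FU(2,3,4) by blast+
    ultimately show ?case
      by (intro exI[of _ "\<Union>k<n. F k"] exI[of _ "\<Union>k. U k"] conjI)
  qed
qed

section \<open>Borel hulls and outer regularity\<close>

context metric_measure_space
begin

lemma borel_subset_sets: "sets borel \<subseteq> sets M"
  using borel_or_completion by auto

lemma open_in_sets: "open U \<Longrightarrow> U \<in> sets M"
  using borel_subset_sets borel_open by blast

lemma space_UNIV: "space M = UNIV"
  using borel_or_completion by (metis sets_eq_imp_space_eq space_borel space_completion)

text \<open>In a completion, a measurable set is a Borel set together with part of a Borel null set;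
  adding the whole null set gives the hull. This carries regularity from Borel sets to all of
  \<open>sets M\<close>.\<close>

lemma borel_hull_null:
  assumes "A \<in> sets M"
  obtains A' where "A' \<in> sets borel" "A \<subseteq> A'" "A' - A \<in> null_sets M"
  using borel_or_completion
proof
  assume "sets M = sets borel"
  then show thesis using that[of A] assms by auto
next
  assume "\<exists>N. sets N = sets borel \<and> M = completion N"
  then obtain N where N: "sets N = sets borel" "M = completion N" by blast
  then obtain S P P' where S: "A = S \<union> P" "P \<subseteq> P'" "P' \<in> null_sets N" "S \<in> sets N"
    using assms sets_completionE by metis
  show thesis
  proof (rule that[of "S \<union> P'"])
    show "S \<union> P' \<in> sets borel" using S N by auto
    show "A \<subseteq> S \<union> P'" using S by auto
    have "P' \<in> null_sets M" using S N null_sets_completionI by blast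
    moreover have "S \<union> P' - A \<in> sets M"
      using S(4) N assms \<open>P' \<in> null_sets M\<close> by (intro sets.Diff sets.Un) auto
    ultimately show "S \<union> P' - A \<in> null_sets M" using S by (elim null_sets_subset) auto
  qed
qed

lemma open_superset_approximation:
  assumes B: "open B" "emeasure M B < \<infinity>" and A: "A \<in> sets M" "A \<subseteq> B" and e: "(0::real) < e"
  obtains U where "open U" "A \<subseteq> U" "U \<subseteq> B" "emeasure M (U - A) < ennreal e"
proof -
  obtain A' where A': "A' \<in> sets borel" "A \<subseteq> A'" "A' - A \<in> null_sets M"
    using borel_hull_null[OF A(1)] .
  obtain F U where FU: "closed F" "open U" "F \<subseteq> A'" "A' \<subseteq> U" "emeasure M (B \<inter> (U - F)) < ennreal e"
    using closed_open_approximation[OF borel_subset_sets B A'(1) e] by blast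
  have m: "B \<inter> (U - F) \<in> sets M"
    using B FU borel_subset_sets borel_closed[OF FU(1)]
    by (intro sets.Int sets.Diff open_in_sets) auto
  have "emeasure M (U \<inter> B - A) \<le> emeasure M ((B \<inter> (U - F)) \<union> (A' - A))"
    using FU A' m by (intro emeasure_mono) auto
  also have "\<dots> = emeasure M (B \<inter> (U - F))"
    using m A'(3) by (rule emeasure_Un_null_set)
  finally have "emeasure M (U \<inter> B - A) < ennreal e" using FU(5) by (rule le_less_trans)
  then show thesis
    using B FU A A' by (intro that[of "U \<inter> B"]) auto
qed

section \<open>Consequences of \<tau>-additivity\<close>

text \<open>The complement of the support is a possibly uncountable union of null balls. Finite
  subunions are null, so \<tau>-additivity makes the whole union null.\<close>

lemma AE_in_supp: "AE x in M. x \<in> supp M"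
proof -
  let ?\<U> = "{ball x r |x r. 0 < r \<and> emeasure M (ball x r) = 0}"
  have "emeasure M (\<Union>?\<U>) = (SUP \<F>\<in>{\<F>. finite \<F> \<and> \<F> \<subseteq> ?\<U>}. emeasure M (\<Union>\<F>))"
    by (rule tau_additive) auto
  also have "\<dots> \<le> 0"
  proof (rule SUP_least)
    fix \<F> assume "\<F> \<in> {\<F>. finite \<F> \<and> \<F> \<subseteq> ?\<U>}"
    then have "finite \<F>" and sub: "\<F> \<subseteq> ?\<U>" by auto
    have "\<Union>\<F> \<in> null_sets M"
    proof (rule null_sets.finite_Union[OF \<open>finite \<F>\<close>])
      show "\<F> \<subseteq> null_sets M" using sub by (auto intro: open_in_sets simp: null_sets_def)
    qed
    then show "emeasure M (\<Union>\<F>) \<le> 0" by auto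
  qed
  finally have "emeasure M (- supp M) = 0" by (simp add: supp_def)
  moreover have "open (- supp M)" by (auto simp: supp_def)
  ultimately have "- supp M \<in> null_sets M"
    by (auto simp: null_sets_def intro: open_in_sets)
  then show ?thesis by (rule AE_I') auto
qed

lemma closed_supp: "closed (supp M)"
  unfolding supp_def by (intro closed_Compl open_Union) auto

lemma emeasure_ball_pos: "x \<in> supp M \<Longrightarrow> 0 < r \<Longrightarrow> 0 < emeasure M (ball x r)"
  by (force simp: supp_def zero_less_iff_neq_zero)

text \<open>The balls of radius \<open>r\<close> around all points cover \<open>B\<close>, and by
  \<tau>-additivity finitely many of them already carry all but \<open>e\<close> of its
  measure.\<close>

lemma finite_ball_cover:
  assumes B: "open B" "emeasure M B < \<infinity>" and "0 < r" and e: "(0::real) < e"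
  obtains X where "finite X" "emeasure M (B - (\<Union>x\<in>X. ball x r)) < ennreal e"
proof -
  let ?\<U> = "range (\<lambda>x. B \<inter> ball x r)"
  have "\<Union>?\<U> = B" using \<open>0 < r\<close> by (auto intro: centre_in_ball[THEN iffD2])
  then have sup: "emeasure M B = (SUP \<F>\<in>{\<F>. finite \<F> \<and> \<F> \<subseteq> ?\<U>}. emeasure M (\<Union>\<F>))"
    using tau_additive[of ?\<U>] B by auto
  have "\<exists>\<F>\<in>{\<F>. finite \<F> \<and> \<F> \<subseteq> ?\<U>}. emeasure M B < emeasure M (\<Union>\<F>) + ennreal e"
    by (rule SUP_approx_ennreal[OF e _ sup]) (use B in auto)
  then obtain \<F> where \<F>: "finite \<F>" "\<F> \<subseteq> ?\<U>" "emeasure M B < emeasure M (\<Union>\<F>) + ennreal e" by blast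
  then obtain X where X: "finite X" "\<F> = (\<lambda>x. B \<inter> ball x r) ` X"
    by (meson finite_subset_image)
  let ?V = "\<Union>x\<in>X. ball x r"
  have V: "\<Union>\<F> = B \<inter> ?V" using X by auto
  have "emeasure M B = emeasure M (B \<inter> ?V) + emeasure M (B - ?V)"
    using B open_in_sets[of ?V] open_in_sets[of B]
    by (subst plus_emeasure) (auto intro!: arg_cong[of _ _ "emeasure M"])
  with \<F>(3) V have lt: "emeasure M (B \<inter> ?V) + emeasure M (B - ?V) < emeasure M (B \<inter> ?V) + ennreal e" by simp
  show thesis
    by (rule that[OF X(1)], rule ccontr) (use lt in \<open>auto simp: not_less dest: add_left_mono leD\<close>)
qed

text \<open>For each \<open>n\<close>, finitely many balls of radius \<open>1 / Suc n\<close> leave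
  out at most \<open>e * (1/2) ^ Suc n\<close> of \<open>B\<close>. Intersecting these finite unions
  over all \<open>n\<close> gives total boundedness at a total loss of \<open>e\<close>.\<close>

lemma totally_bounded_exhaustion:
  assumes B: "open B" "emeasure M B < \<infinity>" and e: "(0::real) < e"
  obtains F where "closed F" "totally_bounded F" "F \<subseteq> supp M" "emeasure M (B - F) \<le> ennreal e"
proof -
  have "\<forall>n. \<exists>X. finite X \<and> emeasure M (B - (\<Union>x\<in>X. ball x (1 / Suc n))) < ennreal (e * (1/2) ^ Suc n)"
  proof
    fix n :: nat
    have "0 < 1 / real (Suc n)" "0 < e * (1/2) ^ Suc n" using e by auto
    from finite_ball_cover[OF B this] show "\<exists>X. finite X \<and>
      emeasure M (B - (\<Union>x\<in>X. ball x (1 / Suc n))) < ennreal (e * (1/2) ^ Suc n)" by metis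
  qed
  then obtain X where X: "\<And>n. finite (X n)"
    "\<And>n. emeasure M (B - (\<Union>x\<in>X n. ball x (1 / Suc n))) < ennreal (e * (1/2) ^ Suc n)" by metis
  \<comment> \<open>Passing to closed balls makes \<open>F\<close> closed and only enlarges the
    finite unions.\<close>
  define F where "F = supp M \<inter> (\<Inter>n. \<Union>x\<in>X n. cball x (1 / Suc n))"
  have "closed F" unfolding F_def using X(1)
    by (intro closed_Int closed_supp closed_INT ballI closed_UN) auto
  moreover have "totally_bounded F"
    unfolding totally_bounded_metric
  proof safe
    fix d :: real assume "0 < d"
    then obtain n where n: "1 / Suc n < d" using nat_approx_posE by blast
    have "F \<subseteq> (\<Union>x\<in>X n. {y. dist x y < d})"
    proof
      fix y assume "y \<in> F"
      then obtain x where "x \<in> X n" "dist x y \<le> 1 / Suc n" by (auto simp: F_def)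
      then show "y \<in> (\<Union>x\<in>X n. {y. dist x y < d})" using n by force
    qed
    then show "\<exists>k. finite k \<and> F \<subseteq> (\<Union>x\<in>k. {y. dist x y < d})" using X(1) by blast
  qed
  moreover have "emeasure M (B - F) \<le> ennreal e"
  proof -
    let ?R = "\<lambda>n. B - (\<Union>x\<in>X n. ball x (1 / Suc n))"
    have R: "?R n \<in> sets M" for n using B by (intro sets.Diff open_in_sets) auto
    have supp0: "- supp M \<in> null_sets M"
      using AE_in_supp closed_supp open_in_sets[of "- supp M"]
      by (subst AE_iff_null_sets) (auto simp: open_Compl)
    have "B - F \<subseteq> (\<Union>n. ?R n) \<union> - supp M"
    proof
      fix y assume "y \<in> B - F"
      then obtain n where n: "y \<notin> supp M \<or> (\<forall>x\<in>X n. y \<notin> cball x (1 / Suc n))" and "y \<in> B"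
        by (auto simp: F_def)
      have "y \<notin> ball x (1 / Suc n)" if "y \<notin> cball x (1 / Suc n)" for x
        using that ball_subset_cball[of x "1 / Suc n"] by blast
      with n \<open>y \<in> B\<close> have "y \<notin> supp M \<or> y \<in> ?R n" by blast
      then show "y \<in> (\<Union>n. ?R n) \<union> - supp M" by blast
    qed
    moreover have UR: "(\<Union>n. ?R n) \<in> sets M" using R by (intro sets.countable_UN) blast
    ultimately have "emeasure M (B - F) \<le> emeasure M ((\<Union>n. ?R n) \<union> - supp M)"
      using supp0 by (intro emeasure_mono sets.Un) (simp_all add: null_setsD2)
    also have "\<dots> = emeasure M (\<Union>n. ?R n)"
      using UR supp0 by (rule emeasure_Un_null_set)
    also have "\<dots> \<le> (\<Sum>n. emeasure M (?R n))"
      using R by (intro emeasure_subadditive_countably) blast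
    also have "\<dots> \<le> (\<Sum>n. ennreal (e * (1/2) ^ Suc n))"
      using X(2) by (intro suminf_le) (auto intro: less_imp_le)
    also have "\<dots> = ennreal e"
      using sums_mult[OF power_half_series, of e] e by (intro suminf_ennreal_eq) auto
    finally show ?thesis .
  qed
  ultimately show thesis by (intro that[of F]) (auto simp: F_def)
qed

section \<open>Sets of low averages at points with doubling scales\<close>

lemma doubling_scales:
  assumes "0 < c" "0 < \<psi>" "0 < \<phi>"
    and lower: "\<And>r. 0 < r \<Longrightarrow> r \<le> \<phi> \<Longrightarrow> ennreal (\<psi> * r powr c) \<le> emeasure M (ball x r)"
  shows "\<exists>n\<ge>m. 0 < emeasure M (cball x ((1/3) ^ n)) \<and>
    emeasure M (cball x (3 * (1/3) ^ n)) \<le> ennreal (3 powr (c + 1)) * emeasure M (cball x ((1/3) ^ n))"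
proof -
  define a where "a n = measure M (cball x ((1/3) ^ n))" for n :: nat
  have a: "emeasure M (cball x ((1/3) ^ n)) = ennreal (a n)" for n
    using finite_on_bounded[of "cball x ((1/3) ^ n)"]
    by (auto simp: a_def intro!: emeasure_eq_ennreal_measure)
  obtain k where k: "(1/3) ^ k < \<phi>" using real_arch_pow_inv[of \<phi> "1/3"] \<open>0 < \<phi>\<close> by auto
  have low: "\<psi> * (1/3) powr (c * real n) \<le> a n" if "n \<ge> max m k" for n
  proof -
    have "(1/3::real) ^ n \<le> (1/3) ^ k" using that by (intro power_decreasing) auto
    with k have "(1/3) ^ n \<le> \<phi>" by (rule order.strict_implies_order[OF le_less_trans, rotated])
    then have "ennreal (\<psi> * ((1/3) ^ n) powr c) \<le> emeasure M (ball x ((1/3) ^ n))"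
      by (intro lower) simp_all
    also have "\<dots> \<le> ennreal (a n)"
      unfolding a[symmetric] using borel_subset_sets borel_closed[OF closed_cball]
      by (intro emeasure_mono ball_subset_cball) blast
    finally have "\<psi> * ((1/3) ^ n) powr c \<le> a n"
      by (simp add: a_def)
    moreover have "((1/3::real) ^ n) powr c = (1/3) powr (c * real n)"
      by (simp add: powr_realpow[symmetric] powr_powr mult.commute)
    ultimately show ?thesis by simp
  qed
  obtain n where n: "n \<ge> max m k" "a n \<le> 3 powr (c + 1) * a (Suc n)"
    using geometric_doubling_scale[OF assms(1,2) low, of "max m k"] by blast
  have "0 < \<psi> * (1/3) powr (c * real (Suc n))" using \<open>0 < \<psi>\<close> by simp
  also have "\<dots> \<le> a (Suc n)" using n(1) by (intro low) auto
  finally have "0 < a (Suc n)" .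
  \<comment> \<open>Tripling the radius \<open>(1/3) ^ Suc n\<close> gives \<open>(1/3) ^ n\<close>,
    so the doubling scale is \<open>Suc n\<close>, not \<open>n\<close>.\<close>
  moreover have "emeasure M (cball x (3 * (1/3) ^ Suc n)) \<le> ennreal (3 powr (c + 1) * a (Suc n))"
    using a[of n] n(2) by (simp add: ennreal_leI)
  ultimately show ?thesis
    using n(1) a[of "Suc n"] \<open>0 < a (Suc n)\<close>
    by (intro exI[of _ "Suc n"]) (simp add: ennreal_mult del: power_Suc)
qed

text \<open>With \<open>V\<close> the union of the Vitali balls and \<open>D = A \<inter> V\<close>,
  the averages give \<open>t * \<mu>(D) \<le> s * \<mu>(V)\<close>, and
  \<open>V - D \<subseteq> U - A\<close> gives \<open>\<mu>(V) \<le> \<mu>(D) + e\<close>. Solving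
  for \<open>\<mu>(D)\<close> yields the constant \<open>s / (t - s)\<close>. Outer approximation is
  applied to the measurable set \<open>A\<close>, since \<open>E\<close> need not be
  measurable.\<close>

lemma AE_notin_low_average_set:
  fixes g :: "'a \<Rightarrow> ennreal" and s t :: real
  assumes g: "g \<in> borel_measurable M" and B: "open B" "emeasure M B < \<infinity>"
    and A: "A \<in> sets M" "A \<subseteq> B" and E: "E \<subseteq> A" and st: "0 \<le> s" "s < t"
    and low: "\<And>x. x \<in> A \<Longrightarrow> ennreal t \<le> g x"
    and avg: "\<And>x r. x \<in> E \<Longrightarrow> 0 < r \<Longrightarrow>
      (\<integral>\<^sup>+y\<in>cball x r. g y \<partial>M) \<le> ennreal s * emeasure M (cball x r)"
    and c: "c < \<infinity>"
    and doubling: "\<And>x m. x \<in> E \<Longrightarrow> \<exists>n\<ge>m. 0 < emeasure M (cball x ((1/3) ^ n)) \<and>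
      emeasure M (cball x (3 * (1/3) ^ n)) \<le> c * emeasure M (cball x ((1/3) ^ n))"
  shows "AE x in M. x \<notin> E"
proof (rule AE_notin_if_arbitrarily_small_cover)
  show "ennreal (s / (t - s)) < \<infinity>" by simp
  fix e :: real assume e: "0 < e"
  obtain U where U: "open U" "A \<subseteq> U" "U \<subseteq> B" "emeasure M (U - A) < ennreal e"
    using open_superset_approximation[OF B A e] .
  have U_fin: "emeasure M U < \<infinity>"
    using emeasure_mono[OF U(3)] B open_in_sets[OF B(1)] by (auto intro: le_less_trans)
  let ?B = "\<lambda>p::'a \<times> nat. cball (fst p) ((1/3) ^ snd p)"
  obtain C where C: "countable C" "fst ` C \<subseteq> E" "disjoint_family_on ?B C" "(\<Union>p\<in>C. ?B p) \<subseteq> U"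
    "AE x in M. x \<in> E \<longrightarrow> x \<in> (\<Union>p\<in>C. ?B p)"
    by (rule doubling_Vitali_covering[OF borel_subset_sets U(1) U_fin order_trans[OF E U(2)] c doubling])
  have B_sets: "?B p \<in> sets M" for p using borel_subset_sets borel_closed[OF closed_cball] by blast
  define V where "V = (\<Union>p\<in>C. ?B p)"
  have V: "V \<in> sets M" unfolding V_def using B_sets C(1) by (intro sets.countable_UN') auto
  define D where "D = A \<inter> V"
  have D: "D \<in> sets M" unfolding D_def using A V by auto
  have U_sets: "U \<in> sets M" using U open_in_sets by auto
  have V_avg: "(\<integral>\<^sup>+y\<in>V. g y \<partial>M) \<le> ennreal s * emeasure M V"
  proof -
    \<comment> \<open>Viewing the integral as the measure \<open>density M g\<close> makes
      additivity over the disjoint balls available.\<close>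
    have "(\<integral>\<^sup>+y\<in>V. g y \<partial>M) = emeasure (density M g) (\<Union>p\<in>C. ?B p)"
      unfolding V_def[symmetric] using V g by (simp add: emeasure_density)
    also have "\<dots> = (\<integral>\<^sup>+p. emeasure (density M g) (?B p) \<partial>count_space C)"
      using B_sets C by (intro emeasure_UN_countable) auto
    also have "\<dots> = (\<integral>\<^sup>+p. (\<integral>\<^sup>+y\<in>?B p. g y \<partial>M) \<partial>count_space C)"
      using B_sets g by (simp add: emeasure_density)
    also have "\<dots> \<le> (\<integral>\<^sup>+p. ennreal s * emeasure M (?B p) \<partial>count_space C)"
      using C(2) by (intro nn_integral_mono avg) auto
    also have "\<dots> = ennreal s * (\<integral>\<^sup>+p. emeasure M (?B p) \<partial>count_space C)"
      by (rule nn_integral_cmult) simp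
    also have "\<dots> = ennreal s * emeasure M V"
      unfolding V_def using B_sets C by (subst emeasure_UN_countable) auto
    finally show ?thesis .
  qed
  have "ennreal t * emeasure M D = (\<integral>\<^sup>+y\<in>D. ennreal t \<partial>M)"
    using D by (simp add: nn_integral_cmult_indicator)
  also have "\<dots> \<le> (\<integral>\<^sup>+y\<in>V. g y \<partial>M)"
    using low by (intro nn_integral_mono) (auto simp: D_def split: split_indicator)
  also note V_avg
  also have "emeasure M V \<le> emeasure M (D \<union> (U - A))"
    using D A U_sets C(4) by (intro emeasure_mono) (auto simp: D_def V_def)
  also have "\<dots> \<le> emeasure M D + emeasure M (U - A)"
    using D A U_sets by (intro emeasure_subadditive) auto
  also have "\<dots> \<le> emeasure M D + ennreal e" using U(4) by (intro add_left_mono) auto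
  finally have main: "ennreal t * emeasure M D \<le> ennreal s * (emeasure M D + ennreal e)"
    by (simp add: mult_left_mono)
  \<comment> \<open>Finiteness of this measure is what allows the inequality to be solved in the
    reals.\<close>
  have "emeasure M D \<le> emeasure M U"
    using U U_sets by (intro emeasure_mono) (auto simp: D_def)
  then have "emeasure M D \<noteq> top" using U_fin by auto
  then obtain d where d: "0 \<le> d" "emeasure M D = ennreal d" by (cases "emeasure M D") auto
  have "t * d \<le> s * (d + e)"
    using main d e st by (simp add: ennreal_mult[symmetric] ennreal_plus[symmetric] del: ennreal_plus)
  then have "d \<le> s / (t - s) * e" using st by (simp add: field_simps)
  then have "emeasure M D \<le> ennreal (s / (t - s)) * ennreal e"
    using st e d by (simp add: ennreal_mult[symmetric])
  moreover have "AE x in M. x \<in> E \<longrightarrow> x \<in> D" using C(5) E by (auto simp: D_def V_def)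
  ultimately show "\<exists>D\<in>sets M. (AE x in M. x \<in> E \<longrightarrow> x \<in> D) \<and> emeasure M D \<le> ennreal (s / (t - s)) * ennreal e"
    using D by blast
qed

section \<open>Exhaustion by countably many totally bounded sets\<close>

lemma AE_countable_totally_bounded_cover:
  obtains F :: "nat \<Rightarrow> 'a set"
  where "\<And>j. closed (F j)" "\<And>j. totally_bounded (F j)" "\<And>j. F j \<subseteq> supp M" "AE x in M. \<exists>j. x \<in> F j"
proof -
  fix x0 :: 'a
  let ?B = "\<lambda>k::nat. ball x0 (Suc k)"
  have fin: "emeasure M (?B k) < \<infinity>" for k by (rule finite_on_bounded) auto
  \<comment> \<open>The first component of \<open>p\<close> selects the ball, the second the
    permitted error; \<open>prod_decode\<close> later turns the pairs into one sequence.\<close>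
  have "\<exists>F. closed F \<and> totally_bounded F \<and> F \<subseteq> supp M \<and> emeasure M (?B (fst p) - F) \<le> ennreal (1 / Suc (snd p))"
    for p :: "nat \<times> nat"
    using totally_bounded_exhaustion[OF open_ball fin, of "1 / Suc (snd p)" "fst p"] by force
  then obtain G :: "nat \<times> nat \<Rightarrow> 'a set" where G: "\<And>p. closed (G p)" "\<And>p. totally_bounded (G p)"
      "\<And>p. G p \<subseteq> supp M" "\<And>p. emeasure M (?B (fst p) - G p) \<le> ennreal (1 / Suc (snd p))"
    by metis
  have "AE x in M. x \<notin> ?B k - (\<Union>p. G p)" for k
  proof (rule AE_notin_if_arbitrarily_small_cover)
    show "(1::ennreal) < \<infinity>" by simp
    fix e :: real assume "0 < e"
    then obtain n where n: "1 / Suc n < e" using nat_approx_posE by blast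
    let ?D = "?B k - G (k, n)"
    have "?D \<in> sets M"
      using G(1) by (intro open_in_sets open_Diff) auto
    moreover have "emeasure M ?D \<le> 1 * ennreal e"
      using order_trans[OF G(4)[of "(k, n)", simplified prod.sel] ennreal_leI[OF less_imp_le[OF n]]] by simp
    ultimately show "\<exists>D\<in>sets M. (AE x in M. x \<in> ?B k - (\<Union>p. G p) \<longrightarrow> x \<in> D) \<and> emeasure M D \<le> 1 * ennreal e"
      by (intro bexI[of _ ?D] conjI AE_I2) auto
  qed
  then have "AE x in M. \<forall>k. x \<notin> ?B k - (\<Union>p. G p)" by (simp only: AE_all_countable) blast
  then have "AE x in M. \<exists>j. x \<in> G (prod_decode j)"
  proof eventually_elim
    case (elim x)
    obtain k :: nat where "dist x0 x < k" using reals_Archimedean2 by blast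
    then have "x \<in> ?B k" by simp
    with elim obtain p where "x \<in> G p" by blast
    then show ?case by (intro exI[of _ "prod_encode p"]) simp
  qed
  then show thesis using G by (intro that[of "\<lambda>j. G (prod_decode j)"]) auto
qed

end

section \<open>Comparison of the maximal function with the absolute value of the function\<close>

theorem corollary4p5:
  fixes M :: "'a::metric_space measure"
  assumes "metric_measure_space M"
    and "\<And>F. closed F \<Longrightarrow> totally_bounded F \<Longrightarrow> F \<subseteq> supp M \<Longrightarrow> 0 < emeasure M F \<Longrightarrow>
           \<exists>(\<psi> :: 'a \<Rightarrow> real) (\<phi> :: 'a \<Rightarrow> real) (c::real). 0 < c \<and>
             (\<forall>x\<in>F. 0 < \<psi> x \<and> 0 < \<phi> x \<and> \<phi> x \<le> 1 \<and>
               (\<forall>r. 0 < r \<and> r \<le> \<phi> x \<longrightarrow> ennreal (\<psi> x * r powr c) \<le> emeasure M (ball x r)))"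
  shows "\<forall>f \<in> L1_loc M. AE x in M. ennreal \<bar>f x\<bar> \<le> centered_maximal M f x"
proof
  interpret metric_measure_space M by fact
  fix f assume "f \<in> L1_loc M"
  then have f [measurable]: "f \<in> borel_measurable M" by (simp add: L1_loc_def)
  obtain F :: "nat \<Rightarrow> 'a set" where F: "\<And>j. closed (F j)" "\<And>j. totally_bounded (F j)" "\<And>j. F j \<subseteq> supp M"
      "AE x in M. \<exists>j. x \<in> F j"
    by (rule AE_countable_totally_bounded_cover) blast
  fix x0 :: 'a
  \<comment> \<open>Each index makes one quantity uniform: \<open>F j\<close> fixes the exponent
    \<open>c\<close>, hence the doubling constant; \<open>k\<close> ensures finite measure;
    \<open>s\<close> and \<open>t\<close> separate the averages from the values. Rational
    \<open>s\<close> and \<open>t\<close> keep the family countable.\<close>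
  define E where "E j k s t = {x \<in> F j \<inter> ball x0 (real k). real_of_rat t \<le> \<bar>f x\<bar> \<and>
      (\<forall>r>0. (\<integral>\<^sup>+y\<in>cball x r. ennreal \<bar>f y\<bar> \<partial>M) \<le> ennreal (real_of_rat s) * emeasure M (cball x r))}"
    for j and k :: nat and s t
  \<comment> \<open>The conditions on \<open>s\<close> and \<open>t\<close> stand inside the
    almost-everywhere statement, so that \<open>AE_all_countable\<close> can quantify over all
    rationals.\<close>
  have null: "AE x in M. 0 \<le> s \<longrightarrow> s < t \<longrightarrow> x \<notin> E j k s t" for j k s t
  proof (cases "0 \<le> s \<and> s < t \<and> 0 < emeasure M (F j)")
    case True
    then obtain \<psi> \<phi> :: "'a \<Rightarrow> real" and c where c: "0 < c"
      and bound: "\<And>x. x \<in> F j \<Longrightarrow> 0 < \<psi> x \<and> 0 < \<phi> x \<and>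
        (\<forall>r. 0 < r \<and> r \<le> \<phi> x \<longrightarrow> ennreal (\<psi> x * r powr c) \<le> emeasure M (ball x r))"
      using assms(2)[OF F(1-3)[of j]] by blast
    have "AE x in M. x \<notin> E j k s t"
    proof (rule AE_notin_low_average_set[where g = "\<lambda>x. ennreal \<bar>f x\<bar>" and B = "ball x0 k"
        and A = "{x \<in> space M. real_of_rat t \<le> \<bar>f x\<bar>} \<inter> ball x0 k"
        and s = "real_of_rat s" and t = "real_of_rat t" and c = "ennreal (3 powr (c + 1))"])
      show "emeasure M (ball x0 k) < \<infinity>" by (rule finite_on_bounded) auto
      show "{x \<in> space M. real_of_rat t \<le> \<bar>f x\<bar>} \<inter> ball x0 k \<in> sets M"
        by (rule sets.Int[OF _ open_in_sets[OF open_ball]]) measurable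
      show "\<exists>n\<ge>m. 0 < emeasure M (cball x ((1/3) ^ n)) \<and> emeasure M (cball x (3 * (1/3) ^ n))
          \<le> ennreal (3 powr (c + 1)) * emeasure M (cball x ((1/3) ^ n))" if "x \<in> E j k s t" for x m
        using bound[of x] that by (intro doubling_scales[OF c, of "\<psi> x" "\<phi> x"]) (auto simp: E_def)
    qed (use True in \<open>auto simp: E_def space_UNIV of_rat_less ennreal_leI\<close>)
    then show ?thesis by eventually_elim auto
  next
    case False
    \<comment> \<open>If \<open>F j\<close> is null, the growth hypothesis says nothing, but
      \<open>E j k s t\<close> is contained in a null set.\<close>
    have "F j \<in> sets M" using borel_subset_sets borel_closed[OF F(1)] by blast
    then have "AE x in M. x \<notin> F j" if "emeasure M (F j) = 0"
      using that by (intro AE_not_in) (auto simp: null_sets_def)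
    then show ?thesis
      using False by (cases "0 \<le> s \<and> s < t") (auto simp: E_def zero_less_iff_neq_zero elim!: eventually_mono)
  qed
  have "AE x in M. \<forall>j k s t. 0 \<le> s \<longrightarrow> s < t \<longrightarrow> x \<notin> E j k s t"
    using null by (simp only: AE_all_countable) blast
  with F(4) AE_in_supp show "AE x in M. ennreal \<bar>f x\<bar> \<le> centered_maximal M f x"
  proof eventually_elim
    case (elim x)
    show ?case
    proof (rule ccontr)
      assume "\<not> ?thesis"
      then have less: "centered_maximal M f x < ennreal \<bar>f x\<bar>" by simp
      then obtain m where m: "0 \<le> m" "centered_maximal M f x = ennreal m"
        by (cases "centered_maximal M f x") auto
      with less have "m < \<bar>f x\<bar>" by (simp add: ennreal_less_iff)
      \<comment> \<open>Both rationals are placed strictly between the maximal function and the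
        value: \<open>s\<close> bounds all averages, \<open>t\<close> stays below the value.\<close>
      then obtain s where s: "m < real_of_rat s" "real_of_rat s < \<bar>f x\<bar>" using of_rat_dense by blast
      then obtain t where t: "real_of_rat s < real_of_rat t" "real_of_rat t < \<bar>f x\<bar>" using of_rat_dense by blast
      have "0 < real_of_rat s" using m(1) s(1) by (rule le_less_trans)
      then have "0 \<le> s" by (simp only: zero_less_of_rat_iff less_imp_le)
      have "s < t" using t(1) by (simp only: of_rat_less)
      obtain j where j: "x \<in> F j" using elim by blast
      obtain k :: nat where k: "dist x0 x < k" using reals_Archimedean2 by blast
      have "(\<integral>\<^sup>+y\<in>cball x r. ennreal \<bar>f y\<bar> \<partial>M) \<le> ennreal (real_of_rat s) * emeasure M (cball x r)" if "0 < r" for r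
      proof -
        let ?I = "\<integral>\<^sup>+y\<in>cball x r. ennreal \<bar>f y\<bar> \<partial>M" and ?m = "emeasure M (cball x r)"
        have "emeasure M (ball x r) \<le> ?m"
          using borel_subset_sets borel_closed[OF closed_cball] by (intro emeasure_mono) auto
        \<comment> \<open>Since \<open>x\<close> is in the support, every radius takes part in the
          supremum, so the bound by \<open>s\<close> holds for all balls around
          \<open>x\<close>.\<close>
        then have pos: "0 < ?m" using emeasure_ball_pos[of x r] elim that by auto
        have fin: "?m < top" using finite_on_bounded[of "cball x r"] by auto
        have "?I / ?m \<le> centered_maximal M f x"
          unfolding centered_maximal_def using that pos by (intro SUP_upper) auto
        also have "\<dots> \<le> ennreal (real_of_rat s)" using m s by (auto intro: ennreal_leI)
        finally have "?I / ?m * ?m \<le> ennreal (real_of_rat s) * ?m" by (rule mult_right_mono) simp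
        then show ?thesis using pos fin by (simp add: ennreal_divide_times)
      qed
      then have "x \<in> E j k s t" using j k t by (auto simp: E_def)
      then show False using elim \<open>0 \<le> s\<close> \<open>s < t\<close> by blast
    qed
  qed
qed

end
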